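(* Let $r\ge 1$ and $n\ge 1$ be integers. Then $$\sum_{k=1}^n k!\,B_{n,k}\big(1!\,x_1,\,2!\,x_2,\,3!\,x_3,\dots,r!\,x_r,0,0,\dots\big)=n!\,F^{[r]}_{n+r-1}(x_1,\dots,x_r),$$ where the arguments $y_i$ of $B_{n,k}$ are $y_i=i!\,x_i$ for $i\le r$ and $y_i=0$ for $i>r$.
   Context: For an integer $r\ge 1$, the $r$-Fibonacci polynomial $F^{[r]}_m(x_1,\dots,x_r)$ is defined by $F^{[r]}_m=0$ for $0\le m<r-1$, $F^{[r]}_{r-1}=1$, and $F^{[r]}_m=\sum_{i=1}^r x_iF^{[r]}_{m-i}$ for $m\ge r$. The partial exponential Bell polynomial is $$B_{n,k}(y_1,\dots,y_{n-k+1})=\sum_{\substack{j_1+\cdots+j_{n-k+1}=k\\ j_1+2j_2+\cdots+(n-k+1)j_{n-k+1}=n}}\frac{n!}{j_1!\cdots j_{n-k+1}!}\Big(\frac{y_1}{1!}\Big)^{j_1}\Big(\frac{y_2}{2!}\Big)^{j_2}\cdots\Big(\frac{y_{n-k+1}}{(n-k+1)!}\Big)^{j_{n-k+1}}$$ (sum over nonnegative integers $j_i$). *)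

theory Defs
  imports Complex_Main "HOL-Library.Poly_Mapping" "HOL-Library.FuncSet"
begin

text \<open>
  Polynomials over the rationals in indeterminates indexed by natural numbers: a monomial is a
  finitely supported exponent vector, a polynomial a finitely supported family of coefficients.
  The product that \<^theory>\<open>HOL-Library.Poly_Mapping\<close> puts on this type is polynomial
  multiplication.
\<close>

type_synonym rat_mpoly = "(nat \<Rightarrow>\<^sub>0 nat) \<Rightarrow>\<^sub>0 rat"

definition Const :: "rat \<Rightarrow> rat_mpoly" where
  "Const c = Poly_Mapping.single 0 c"

definition X :: "nat \<Rightarrow> rat_mpoly" where
  "X i = Poly_Mapping.single (Poly_Mapping.single i 1) 1"

text \<open>
  The recursion is meant for \<open>r \<ge> 1\<close>. In its last branch \<open>m \<ge> r\<close>, so \<open>m - i\<close> never truncates.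
\<close>

function rfib :: "nat \<Rightarrow> nat \<Rightarrow> rat_mpoly" where
  "rfib r m =
     (if m < r - 1 then 0
      else if m = r - 1 then 1
      else (\<Sum>i = 1..r. X i * rfib r (m - i)))"
  by auto
termination
  by (relation "measure snd") auto

declare rfib.simps [simp del]

text \<open>
  The families \<open>(j\<^sub>1, \<dots>, j\<^bsub>n-k+1\<^esub>)\<close> over which the partial Bell polynomial sums. Extensional
  functions are used so that each family is represented exactly once. For \<open>k > n\<close> the truncated
  difference leaves the index range \<open>{1}\<close>, and the set is empty.
\<close>

definition bell_index :: "nat \<Rightarrow> nat \<Rightarrow> (nat \<Rightarrow> nat) set" where
  "bell_index n k =
     {j \<in> {1..n - k + 1} \<rightarrow>\<^sub>E UNIV.
        (\<Sum>i = 1..n - k + 1. j i) = k \<and> (\<Sum>i = 1..n - k + 1. i * j i) = n}"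

lemma finite_bell_index: "finite (bell_index n k)"
proof (rule finite_subset)
  show "bell_index n k \<subseteq> {1..n - k + 1} \<rightarrow>\<^sub>E {..k}"
  proof
    fix j assume j: "j \<in> bell_index n k"
    have "j i \<le> k" if "i \<in> {1..n - k + 1}" for i
      using j member_le_sum[OF that, of j] by (simp add: bell_index_def)
    with j show "j \<in> {1..n - k + 1} \<rightarrow>\<^sub>E {..k}"
      by (auto simp: bell_index_def PiE_iff)
  qed
  show "finite ({1..n - k + 1} \<rightarrow>\<^sub>E {..k})"
    by (intro finite_PiE) auto
qed

text \<open>
  \<open>bell n k y\<close> is the value of \<open>B\<^bsub>n,k\<^esub>\<close> at polynomial arguments \<open>y 1, \<dots>, y (n - k + 1)\<close>.
  The rational coefficients enter through \<^const>\<open>Const\<close>.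
\<close>

definition bell :: "nat \<Rightarrow> nat \<Rightarrow> (nat \<Rightarrow> rat_mpoly) \<Rightarrow> rat_mpoly" where
  "bell n k y =
     (\<Sum>j \<in> bell_index n k.
        Const (fact n / (\<Prod>i = 1..n - k + 1. fact (j i))) *
        (\<Prod>i = 1..n - k + 1. (Const (1 / fact i) * y i) ^ j i))"

end

theory Submission
  imports Defs
begin

text \<open>
  Write \<open>A k n = k! B\<^bsub>n,k\<^esub>(1! y\<^sub>1, 2! y\<^sub>2, \<dots>) / n!\<close>, the coefficient of \<open>t\<^sup>n\<close> in
  \<open>(\<Sum>i. y\<^sub>i t\<^sup>i)\<^sup>k\<close>. Weighting every exponent vector \<open>j\<close> by \<open>j\<^sub>i\<close>, summing over \<open>i\<close> and
  lowering \<open>j\<^sub>i\<close> by one yields \<open>A (k + 1) n = (\<Sum>i. y\<^sub>i A k (n - i))\<close>. Summed over \<open>k\<close>, this is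
  the recursion of the \<open>r\<close>-Fibonacci polynomials.
\<close>

section \<open>Rational constants as polynomials\<close>

lemma Const_0 [simp]: "Const 0 = 0"
  by (simp add: Const_def)

lemma Const_1 [simp]: "Const 1 = 1"
  by (simp add: Const_def)

lemma Const_add: "Const (a + b) = Const a + Const b"
  by (simp add: Const_def single_add)

lemma Const_mult: "Const (a * b) = Const a * Const b"
  by (simp add: Const_def mult_single)

lemma Const_sum: "Const (sum f A) = (\<Sum>i\<in>A. Const (f i))"
  by (induction A rule: infinite_finite_induct) (simp_all add: Const_add)

lemma Const_prod: "Const (prod f A) = (\<Prod>i\<in>A. Const (f i))"
  by (induction A rule: infinite_finite_induct) (simp_all add: Const_mult)

section \<open>Coefficients of powers of a series without constant term\<close>

text \<open>
  Unlike in \<^const>\<open>bell_index\<close>, the length \<open>N\<close> of the exponent vectors does not depend on \<open>n\<close>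
  and \<open>k\<close>, so that changing a single exponent stays within this family of sets.
\<close>

definition part_index :: "nat \<Rightarrow> nat \<Rightarrow> nat \<Rightarrow> (nat \<Rightarrow> nat) set" where
  "part_index N k n =
     {j. (\<forall>i. i \<notin> {1..N} \<longrightarrow> j i = 0) \<and> (\<Sum>i = 1..N. j i) = k \<and> (\<Sum>i = 1..N. i * j i) = n}"

definition weight :: "(nat \<Rightarrow> rat_mpoly) \<Rightarrow> nat \<Rightarrow> (nat \<Rightarrow> nat) \<Rightarrow> rat_mpoly" where
  "weight y N j = (\<Prod>i = 1..N. Const (1 / fact (j i)) * y i ^ j i)"

text \<open>By the multinomial theorem, this is the coefficient of t^n in (y 1 * t + ... + y N *
  t^N)^k.\<close>

definition power_coeff :: "(nat \<Rightarrow> rat_mpoly) \<Rightarrow> nat \<Rightarrow> nat \<Rightarrow> nat \<Rightarrow> rat_mpoly" where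
  "power_coeff y N k n = Const (fact k) * (\<Sum>j \<in> part_index N k n. weight y N j)"

lemma part_index_0: "part_index N 0 n = (if n = 0 then {\<lambda>_. 0} else {})"
  by (auto simp: part_index_def fun_eq_iff) (metis atLeastAtMost_iff)

lemma part_index_eq_empty:
  assumes "n < k"
  shows "part_index N k n = {}"
proof -
  have "j \<notin> part_index N k n" for j
  proof -
    have "(\<Sum>i = 1..N. j i) \<le> (\<Sum>i = 1..N. i * j i)"
      by (intro sum_mono) auto
    with assms show ?thesis
      by (auto simp: part_index_def)
  qed
  then show ?thesis
    by blast
qed

lemma part_index_incr_iff:
  assumes "i \<in> {1..N}"
  shows "j(i := Suc (j i)) \<in> part_index N (Suc k) (n + i) \<longleftrightarrow> j \<in> part_index N k n"
proof -
  have "(\<Sum>l = 1..N. (j(i := Suc (j i))) l) = (\<Sum>l = 1..N. j l) + 1"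
    using assms by (simp add: sum.remove[of _ i])
  moreover have "(\<Sum>l = 1..N. l * (j(i := Suc (j i))) l) = (\<Sum>l = 1..N. l * j l) + i"
    using assms by (simp add: sum.remove[of _ i])
  ultimately show ?thesis
    using assms by (auto simp: part_index_def)
qed

lemma Const_1_div_fact_Suc:
  "Const (of_nat (Suc m)) * Const (1 / fact (Suc m)) = Const (1 / fact m)"
proof -
  have "of_nat (Suc m) * (1 / fact (Suc m)) = (1 / fact m :: rat)"
    by (simp add: field_simps del: of_nat_Suc)
  then show ?thesis
    by (metis Const_mult)
qed

text \<open>The factor j i + 1 cancels against the new factorial, which leaves one additional power
  of y i.\<close>

lemma weight_incr:
  assumes "i \<in> {1..N}"
  shows "Const (of_nat (Suc (j i))) * weight y N (j(i := Suc (j i))) = y i * weight y N j"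
proof -
  let ?P = "\<Prod>l \<in> {1..N} - {i}. Const (1 / fact (j l)) * y l ^ j l"
  have "weight y N (j(i := Suc (j i))) = Const (1 / fact (Suc (j i))) * y i ^ Suc (j i) * ?P"
    using assms unfolding weight_def by (simp add: prod.remove[of _ i] del: fact_Suc)
  moreover have "weight y N j = Const (1 / fact (j i)) * y i ^ j i * ?P"
    using assms unfolding weight_def by (simp add: prod.remove[of _ i])
  ultimately show ?thesis
    using Const_1_div_fact_Suc[of "j i"] by (simp add: mult_ac del: fact_Suc of_nat_Suc)
qed

lemma finite_part_index: "finite (part_index N k n)"
proof (rule finite_subset)
  show "part_index N k n \<subseteq> {j. \<forall>i. (i \<in> {1..N} \<longrightarrow> j i \<in> {..k}) \<and> (i \<notin> {1..N} \<longrightarrow> j i = 0)}"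
  proof (clarsimp simp: part_index_def)
    fix j :: "nat \<Rightarrow> nat" and i
    assume "Suc 0 \<le> i" "i \<le> N"
    then show "j i \<le> sum j {Suc 0..N}"
      by (intro member_le_sum) auto
  qed
qed (intro finite_set_of_finite_funs; simp)

text \<open>Vectors with j i = 0 contribute nothing; on the others, lowering j i by one is a
  bijection onto the smaller index set. The case i > n is separate because n - i would truncate:
  there every j i is 0, since i * j i is at most n.\<close>

lemma sum_exponent_weight:
  assumes i: "i \<in> {1..N}"
  shows "(\<Sum>j \<in> part_index N (Suc k) n. Const (of_nat (j i)) * weight y N j) =
         (if i \<le> n then y i * (\<Sum>j \<in> part_index N k (n - i). weight y N j) else 0)"
proof (cases "i \<le> n")
  case True
  have "(\<Sum>j \<in> part_index N (Suc k) n. Const (of_nat (j i)) * weight y N j) =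
        (\<Sum>j \<in> {j \<in> part_index N (Suc k) n. j i \<noteq> 0}. Const (of_nat (j i)) * weight y N j)"
    by (rule sum.mono_neutral_right) (auto simp: finite_part_index)
  also have "\<dots> = (\<Sum>j \<in> part_index N k (n - i). y i * weight y N j)"
  proof (rule sum.reindex_bij_witness[where i = "\<lambda>j. j(i := Suc (j i))" and j = "\<lambda>j. j(i := j i - 1)"])
    fix j assume j: "j \<in> {j \<in> part_index N (Suc k) n. j i \<noteq> 0}"
    then show "j(i := j i - 1, i := Suc ((j(i := j i - 1)) i)) = j"
      by auto
    from j show "j(i := j i - 1) \<in> part_index N k (n - i)"
      using part_index_incr_iff[OF i, of "j(i := j i - 1)" k "n - i"] True by simp
    from j show "y i * weight y N (j(i := j i - 1)) = Const (of_nat (j i)) * weight y N j"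
      using weight_incr[OF i, of "j(i := j i - 1)" y] by (simp del: of_nat_Suc)
  next
    fix j assume "j \<in> part_index N k (n - i)"
    then show "j(i := Suc (j i)) \<in> {j \<in> part_index N (Suc k) n. j i \<noteq> 0}"
      using part_index_incr_iff[OF i, of j k "n - i"] True by simp
  qed auto
  finally show ?thesis
    using True by (simp add: sum_distrib_left)
next
  case False
  have "j i = 0" if "j \<in> part_index N (Suc k) n" for j
  proof (rule ccontr)
    assume "j i \<noteq> 0"
    then have "i \<le> i * j i" by simp
    also have "\<dots> \<le> (\<Sum>l = 1..N. l * j l)"
      using i by (intro member_le_sum) auto
    finally show False
      using that False by (simp add: part_index_def)
  qed
  then have "(\<Sum>j \<in> part_index N (Suc k) n. Const (of_nat (j i)) * weight y N j) = 0"
    by (metis (no_types, lifting) Const_0 mult_zero_left of_nat_0 sum.neutral)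
  with False show ?thesis
    by simp
qed

text \<open>The exponents of each vector add up to k + 1, so weighting by j i and summing over i
  multiplies by k + 1, the factor that separates \<open>fact (Suc k)\<close> from
  \<open>fact k\<close>.\<close>

lemma power_coeff_Suc:
  "power_coeff y N (Suc k) n =
   (\<Sum>i = 1..N. if i \<le> n then y i * power_coeff y N k (n - i) else 0)"
proof -
  have "Const (of_nat (Suc k)) * (\<Sum>j \<in> part_index N (Suc k) n. weight y N j) =
        (\<Sum>j \<in> part_index N (Suc k) n. \<Sum>i = 1..N. Const (of_nat (j i)) * weight y N j)"
    unfolding sum_distrib_left
  proof (rule sum.cong)
    fix j assume "j \<in> part_index N (Suc k) n"
    then have "of_nat (Suc k) = (\<Sum>i = 1..N. of_nat (j i) :: rat)"
      unfolding part_index_def of_nat_sum[symmetric] by simp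
    then show "Const (of_nat (Suc k)) * weight y N j =
               (\<Sum>i = 1..N. Const (of_nat (j i)) * weight y N j)"
      by (simp only: Const_sum sum_distrib_right)
  qed simp
  also have "\<dots> = (\<Sum>i = 1..N. \<Sum>j \<in> part_index N (Suc k) n. Const (of_nat (j i)) * weight y N j)"
    by (rule sum.swap)
  also have "\<dots> = (\<Sum>i = 1..N. if i \<le> n then y i * (\<Sum>j \<in> part_index N k (n - i). weight y N j) else 0)"
    by (intro sum.cong sum_exponent_weight) auto
  finally have "power_coeff y N (Suc k) n = Const (fact k) *
      (\<Sum>i = 1..N. if i \<le> n then y i * (\<Sum>j \<in> part_index N k (n - i). weight y N j) else 0)"
    by (simp add: power_coeff_def Const_mult mult_ac del: of_nat_Suc)
  also have "\<dots> = (\<Sum>i = 1..N. if i \<le> n then y i * power_coeff y N k (n - i) else 0)"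
    by (subst sum_distrib_left, intro sum.cong) (auto simp: power_coeff_def mult_ac)
  finally show ?thesis .
qed

lemma power_coeff_0: "power_coeff y N 0 n = (if n = 0 then 1 else 0)"
  by (simp add: power_coeff_def part_index_0 weight_def)

lemma power_coeff_eq_0: "n < k \<Longrightarrow> power_coeff y N k n = 0"
  by (simp add: power_coeff_def part_index_eq_empty)

text \<open>For f = y 1 * t + ... + y N * t^N, the geometric series S = 1 + f + f^2 + ... satisfies
  S = 1 + f * S; this is its coefficient at t^m. As f has no constant term, powers beyond N do not
  reach degree m.\<close>

lemma sum_power_coeff_rec:
  assumes "1 \<le> m" "m \<le> N"
  shows "(\<Sum>k\<le>N. power_coeff y N k m) = (\<Sum>i = 1..m. y i * (\<Sum>k\<le>N. power_coeff y N k (m - i)))"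
proof -
  obtain M where M: "N = Suc M"
    using assms by (cases N) auto
  \<comment> \<open>The term for k = 0 vanishes because m is positive.\<close>
  have "(\<Sum>k\<le>N. power_coeff y N k m) = (\<Sum>k\<le>M. power_coeff y N (Suc k) m)"
    using assms unfolding M sum.atMost_Suc_shift by (simp add: power_coeff_0)
  also have "\<dots> = (\<Sum>k\<le>M. \<Sum>i = 1..m. y i * power_coeff y N k (m - i))"
    using assms unfolding power_coeff_Suc
    by (intro sum.cong sum.mono_neutral_cong_right) auto
  also have "\<dots> = (\<Sum>i = 1..m. y i * (\<Sum>k\<le>M. power_coeff y N k (m - i)))"
    unfolding sum_distrib_left by (rule sum.swap)
  \<comment> \<open>The added term k = N is zero because m - i < N.\<close>
  also have "\<dots> = (\<Sum>i = 1..m. y i * (\<Sum>k\<le>N. power_coeff y N k (m - i)))"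
    using assms by (intro sum.cong) (auto simp: M power_coeff_eq_0)
  finally show ?thesis .
qed

section \<open>The recursion of the r-Fibonacci polynomials\<close>

text \<open>The shift by r - 1 puts the initial value 1 at m = 0. Summing up to m instead of r gives
  the shape of \<open>sum_power_coeff_rec\<close>: terms with i > m meet the zero initial values,
  terms with i > r have coefficient 0.\<close>

lemma rfib_rec:
  assumes "1 \<le> r" "1 \<le> m"
  shows "rfib r (m + r - 1) =
         (\<Sum>i = 1..m. (if i \<le> r then X i else 0) * rfib r (m - i + r - 1))"
proof -
  have zero: "rfib r l = 0" if "l < r - 1" for l
    using that by (simp add: rfib.simps)
  have "rfib r (m + r - 1) = (\<Sum>i = 1..r. X i * rfib r (m + r - 1 - i))"
    using assms by (subst rfib.simps) auto
  also have "\<dots> = (\<Sum>i \<in> {1..r} \<inter> {1..m}. X i * rfib r (m + r - 1 - i))"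
  proof (rule sum.mono_neutral_right)
    show "\<forall>i \<in> {1..r} - {1..r} \<inter> {1..m}. X i * rfib r (m + r - 1 - i) = 0"
    proof
      fix i assume "i \<in> {1..r} - {1..r} \<inter> {1..m}"
      then have "m + r - 1 - i < r - 1" using assms by auto
      then show "X i * rfib r (m + r - 1 - i) = 0" by (simp add: zero)
    qed
  qed auto
  also have "\<dots> = (\<Sum>i = 1..m. (if i \<le> r then X i else 0) * rfib r (m - i + r - 1))"
    using assms by (intro sum.mono_neutral_cong_left) auto
  finally show ?thesis .
qed

text \<open>Both sides equal 1 at m = 0 and obey the same recursion. The length N stays fixed
  throughout the strong induction on m.\<close>

lemma sum_power_coeff_eq_rfib:
  assumes "1 \<le> r" "m \<le> N"
  shows "(\<Sum>k\<le>N. power_coeff (\<lambda>i. if i \<le> r then X i else 0) N k m) = rfib r (m + r - 1)"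
  using assms(2)
proof (induction m rule: less_induct)
  case (less m)
  show ?case
  proof (cases "m = 0")
    case True
    then show ?thesis
      unfolding sum.atMost_shift by (simp add: power_coeff_0 power_coeff_eq_0 rfib.simps)
  next
    case False
    let ?y = "\<lambda>i. if i \<le> r then X i else 0"
    from False less.prems have "(\<Sum>k\<le>N. power_coeff ?y N k m) =
        (\<Sum>i = 1..m. ?y i * (\<Sum>k\<le>N. power_coeff ?y N k (m - i)))"
      by (intro sum_power_coeff_rec) auto
    also have "\<dots> = (\<Sum>i = 1..m. ?y i * rfib r (m - i + r - 1))"
      using less.prems by (intro sum.cong arg_cong2[where f = "(*)"] less.IH) auto
    also have "\<dots> = rfib r (m + r - 1)"
      using False assms(1) by (intro rfib_rec[symmetric]) auto
    finally show ?thesis .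
  qed
qed

section \<open>Changing the length of the exponent vectors\<close>

text \<open>If a part of size i occurs, the other k - 1 parts have size at least 1, hence i + k - 1
  is at most n.\<close>

lemma part_index_support:
  assumes j: "j \<in> part_index N k n" and i: "i > n - k + 1"
  shows "j i = 0"
proof (rule ccontr)
  assume nz: "j i \<noteq> 0"
  then have iN: "i \<in> {1..N}" using j by (auto simp: part_index_def)
  have "(\<Sum>l \<in> {1..N} - {i}. j l) \<le> (\<Sum>l \<in> {1..N} - {i}. l * j l)"
    by (intro sum_mono) auto
  moreover have "i - 1 \<le> (i - 1) * j i" using nz by simp
  moreover have "i * j i = (i - 1) * j i + j i" using iN by (cases i) auto
  moreover have "j i + (\<Sum>l \<in> {1..N} - {i}. j l) = k"
    "i * j i + (\<Sum>l \<in> {1..N} - {i}. l * j l) = n"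
    using j iN by (auto simp: part_index_def sum.remove[of _ i])
  ultimately show False using i by linarith
qed

lemma part_index_shrink:
  assumes "n - k + 1 \<le> N"
  shows "part_index N k n = part_index (n - k + 1) k n"
proof -
  have eq: "(\<Sum>i = 1..N. f i * j i) = (\<Sum>i = 1..n - k + 1. f i * j i)"
    if "\<And>i. i > n - k + 1 \<Longrightarrow> j i = 0" for f j :: "nat \<Rightarrow> nat"
    using assms that by (intro sum.mono_neutral_right) auto
  have "j \<in> part_index N k n \<longleftrightarrow> j \<in> part_index (n - k + 1) k n" for j
  proof (cases "\<forall>i > n - k + 1. j i = 0")
    case True
    then show ?thesis
      using eq[of j "\<lambda>_. 1"] eq[of j "\<lambda>i. i"] assms
      by (auto simp: part_index_def not_le)
  next
    case False
    then show ?thesis using part_index_support by blast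
  qed
  then show ?thesis by blast
qed

lemma weight_shrink:
  assumes "n - k + 1 \<le> N" "j \<in> part_index N k n"
  shows "weight y N j = weight y (n - k + 1) j"
  unfolding weight_def
  using assms part_index_support[OF assms(2)] by (intro prod.mono_neutral_right) auto

lemma power_coeff_shrink:
  assumes "n - k + 1 \<le> N"
  shows "power_coeff y N k n = power_coeff y (n - k + 1) k n"
  using weight_shrink[OF assms] by (simp add: power_coeff_def part_index_shrink[OF assms])

section \<open>Comparison with the partial Bell polynomials\<close>

text \<open>The factor \<open>fact i\<close> in the argument cancels the denominator i! in the
  definition of \<open>bell\<close>.\<close>

lemma bell_eq_sum_weight:
  "bell n k (\<lambda>i. Const (fact i) * y i) =
   Const (fact n) * (\<Sum>j \<in> part_index (n - k + 1) k n. weight y (n - k + 1) j)"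
proof -
  let ?I = "{1..n - k + 1}"
  have "bell n k (\<lambda>i. Const (fact i) * y i) =
        (\<Sum>j \<in> bell_index n k. Const (fact n) * weight y (n - k + 1) j)"
    unfolding bell_def
  proof (rule sum.cong)
    fix j assume "j \<in> bell_index n k"
    have "Const (1 / fact i) * (Const (fact i) * y i) = y i" for i
      by (simp add: mult.assoc[symmetric] Const_mult[symmetric])
    moreover have "Const (fact n / (\<Prod>i\<in>?I. fact (j i))) =
        Const (fact n) * (\<Prod>i\<in>?I. Const (1 / fact (j i)))"
      by (simp add: Const_prod[symmetric] Const_mult[symmetric] prod_dividef)
    ultimately show "Const (fact n / (\<Prod>i\<in>?I. fact (j i))) *
        (\<Prod>i\<in>?I. (Const (1 / fact i) * (Const (fact i) * y i)) ^ j i) =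
        Const (fact n) * weight y (n - k + 1) j"
      by (simp only: weight_def prod.distrib mult.assoc)
  qed simp
  also have "\<dots> = (\<Sum>j \<in> part_index (n - k + 1) k n. Const (fact n) * weight y (n - k + 1) j)"
    \<comment> \<open>Outside the index range, the default \<open>undefined\<close> of extensional
      functions is exchanged for 0; \<open>restrict\<close> is the inverse map.\<close>
    by (rule sum.reindex_bij_witness[where i = "\<lambda>j. restrict j ?I"
          and j = "\<lambda>j i. if i \<in> ?I then j i else 0"])
      (auto simp: bell_index_def part_index_def weight_def fun_eq_iff PiE_iff extensional_def
        intro!: arg_cong2[where f = "(*)"] prod.cong)
  finally show ?thesis
    by (simp add: sum_distrib_left)
qed

theorem theorem5p6:
  fixes r n :: nat
  assumes "r \<ge> 1" and "n \<ge> 1"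
  shows "(\<Sum>k = 1..n. Const (fact k) *
            bell n k (\<lambda>i. if i \<le> r then Const (fact i) * X i else 0))
         = Const (fact n) * rfib r (n + r - 1)"
proof -
  let ?y = "\<lambda>i. if i \<le> r then X i else 0"
  have y: "(\<lambda>i. if i \<le> r then Const (fact i) * X i else 0) = (\<lambda>i. Const (fact i) * ?y i)"
    by auto
  have "(\<Sum>k = 1..n. Const (fact k) * bell n k (\<lambda>i. if i \<le> r then Const (fact i) * X i else 0)) =
        (\<Sum>k = 1..n. Const (fact n) * power_coeff ?y n k n)"
  proof (rule sum.cong)
    fix k assume "k \<in> {1..n}"
    \<comment> \<open>Since k is at least 1, the length n - k + 1 is at most n, so the common length
      n serves every k.\<close>
    then have "power_coeff ?y n k n = power_coeff ?y (n - k + 1) k n"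
      by (intro power_coeff_shrink) auto
    then show "Const (fact k) * bell n k (\<lambda>i. if i \<le> r then Const (fact i) * X i else 0) =
               Const (fact n) * power_coeff ?y n k n"
      unfolding y bell_eq_sum_weight by (simp only: power_coeff_def mult.left_commute)
  qed simp
  \<comment> \<open>Including k = 0 changes nothing because n is positive.\<close>
  also have "\<dots> = Const (fact n) * (\<Sum>k\<le>n. power_coeff ?y n k n)"
    using assms unfolding sum_distrib_left
    by (intro sum.mono_neutral_left) (auto simp: power_coeff_0 Suc_le_eq)
  also have "\<dots> = Const (fact n) * rfib r (n + r - 1)"
    using assms by (simp add: sum_power_coeff_eq_rfib)
  finally show ?thesis .
qed

end
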